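(* Let $H\in(1/2,1)$, $a\in\mathbb{R}$, and let $B^H=(B^H_t)_{t\ge 0}$ be a fractional Brownian motion with Hurst parameter $H$. For every integer $N\ge 1$ let $0=\tau_0,\tau_1,\dots,\tau_N$ (depending on $N$) be random sampling times, independent of $B^H$, which are (for all $N$) either given by jittered sampling or given by renewal process sampling (both defined in the context). Let the observations satisfy $Y_{\tau_{i+1}}=a\,\tau_{i+1}+B^H_{\tau_{i+1}}-B^H_{\tau_i}$ for $i=0,\dots,N-1$, and let $$\hat a_N=\frac{\sum_{i=0}^{N-1}\tau_{i+1}Y_{\tau_{i+1}}}{\sum_{i=0}^{N-1}\tau_{i+1}^2}$$ be the least squares estimator of $a$. Then $\hat a_N$ is strongly consistent, that is, $$\hat a_N\longrightarrow a\quad\text{almost surely as }N\to\infty .$$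
   Context: Fractional Brownian motion $B^H$ with Hurst parameter $H$: the centered Gaussian process (with continuous paths) with covariance $\mathbb{E}[B^H_tB^H_s]=\frac{\sigma^2}{2}\left(|t|^{2H}+|s|^{2H}-|t-s|^{2H}\right)$, where $\sigma>0$ is a constant. Sampling times. $N$ is the (deterministic) number of observations, and the sampling times depend on $N$; all random variables, for all $N$, are defined on a common probability space. Jittered sampling: $\tau_0=0$ and $\tau_i=\frac{i}{N}+\nu_i$ for $1\le i\le N$, where $\nu_1,\dots,\nu_N$ (depending on $N$) are independent random variables, each uniformly distributed on $\left[-\frac{1}{2N},\frac{1}{2N}\right]$. Renewal process sampling: $\tau_0=0$ and $\tau_i=\sum_{j=1}^{i}t_j$ for $1\le i\le N$, where $t_1,\dots,t_N$ (depending on $N$) are independent exponential random variables with parameter (rate) $N$, so that $\mathbb{E}[t_j]=1/N$. *)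

theory Defs
  imports "HOL-Probability.Probability"
begin

definition gaussian_rv :: "'w measure \<Rightarrow> ('w \<Rightarrow> real) \<Rightarrow> bool" where
  "gaussian_rv M X \<longleftrightarrow> X \<in> borel_measurable M \<and>
     ((\<exists>\<mu>. distr M borel X = return borel \<mu>) \<or>
      (\<exists>\<mu> s. 0 < s \<and> distributed M lborel X (normal_density \<mu> s)))"
  \<comment> \<open>The first disjunct is the degenerate case of variance 0, which \<^const>\<open>normal_density\<close> does
      not cover; it is needed, e.g., for fractional Brownian motion at time 0.\<close>

text \<open>All finite-dimensional distributions are (possibly degenerate) multivariate normal, i.e.
  every finite linear combination is a univariate normal variable.\<close>

definition gaussian_process ::
    "'w measure \<Rightarrow> 't set \<Rightarrow> ('t \<Rightarrow> 'w \<Rightarrow> real) \<Rightarrow> bool" where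
  "gaussian_process M T X \<longleftrightarrow>
     (\<forall>t\<in>T. X t \<in> borel_measurable M) \<and>
     (\<forall>F c. finite F \<longrightarrow> F \<subseteq> T \<longrightarrow> gaussian_rv M (\<lambda>\<omega>. \<Sum>t\<in>F. c t * X t \<omega>))"

text \<open>The time set is \<open>{0..}\<close>; the values of \<open>B\<close> at negative times are unconstrained.\<close>

definition fractional_brownian_motion ::
    "'w measure \<Rightarrow> real \<Rightarrow> real \<Rightarrow> (real \<Rightarrow> 'w \<Rightarrow> real) \<Rightarrow> bool" where
  "fractional_brownian_motion M H \<sigma> B \<longleftrightarrow>
     gaussian_process M {0..} B \<and>
     (\<forall>t\<ge>0. integral\<^sup>L M (B t) = 0) \<and>
     (\<forall>t\<ge>0. \<forall>s\<ge>0. integral\<^sup>L M (\<lambda>\<omega>. B t \<omega> * B s \<omega>) =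
        \<sigma>\<^sup>2 / 2 * (\<bar>t\<bar> powr (2 * H) + \<bar>s\<bar> powr (2 * H) - \<bar>t - s\<bar> powr (2 * H))) \<and>
     (\<forall>\<omega>\<in>space M. continuous_on {0..} (\<lambda>t. B t \<omega>))"

definition jittered_sampling :: "'w measure \<Rightarrow> nat \<Rightarrow> (nat \<Rightarrow> 'w \<Rightarrow> real) \<Rightarrow> bool" where
  "jittered_sampling M N \<tau> \<longleftrightarrow>
     (\<exists>\<nu>. prob_space.indep_vars M (\<lambda>_. borel) \<nu> {1..N} \<and>
        (\<forall>i\<in>{1..N}. distr M borel (\<nu> i) =
           uniform_measure lborel {- 1 / (2 * real N) .. 1 / (2 * real N)}) \<and>
        (\<forall>\<omega>\<in>space M. \<tau> 0 \<omega> = 0 \<and> (\<forall>i\<in>{1..N}. \<tau> i \<omega> = real i / real N + \<nu> i \<omega>)))"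

definition renewal_sampling :: "'w measure \<Rightarrow> nat \<Rightarrow> (nat \<Rightarrow> 'w \<Rightarrow> real) \<Rightarrow> bool" where
  "renewal_sampling M N \<tau> \<longleftrightarrow>
     (\<exists>t. prob_space.indep_vars M (\<lambda>_. borel) t {1..N} \<and>
        (\<forall>j\<in>{1..N}. distributed M lborel (t j) (exponential_density (real N))) \<and>
        (\<forall>\<omega>\<in>space M. \<tau> 0 \<omega> = 0 \<and> (\<forall>i\<in>{1..N}. \<tau> i \<omega> = (\<Sum>j=1..i. t j \<omega>))))"

text \<open>Independence of the \<open>\<sigma>\<close>-algebras generated by \<open>\<tau> 0, \<dots>, \<tau> N\<close> and by the whole
  process \<open>B\<close> on \<open>{0..}\<close>, expressed through the induced random elements of product spaces.\<close>

definition times_indep_of_process ::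
    "'w measure \<Rightarrow> nat \<Rightarrow> (nat \<Rightarrow> 'w \<Rightarrow> real) \<Rightarrow> (real \<Rightarrow> 'w \<Rightarrow> real) \<Rightarrow> bool" where
  "times_indep_of_process M N \<tau> B \<longleftrightarrow>
     prob_space.indep_var M
       (Pi\<^sub>M {0..N} (\<lambda>_. borel)) (\<lambda>\<omega>. \<lambda>i\<in>{0..N}. \<tau> i \<omega>)
       (Pi\<^sub>M {0..} (\<lambda>_. borel)) (\<lambda>\<omega>. \<lambda>t\<in>{0..}. B t \<omega>)"

text \<open>\<open>Y i\<close> stands for the observation made at the random time \<open>\<tau> i\<close>.\<close>

definition least_squares_estimator ::
    "nat \<Rightarrow> (nat \<Rightarrow> 'w \<Rightarrow> real) \<Rightarrow> (nat \<Rightarrow> 'w \<Rightarrow> real) \<Rightarrow> 'w \<Rightarrow> real" where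
  "least_squares_estimator N \<tau> Y \<omega> =
     (\<Sum>i=0..<N. \<tau> (i + 1) \<omega> * Y (i + 1) \<omega>) / (\<Sum>i=0..<N. (\<tau> (i + 1) \<omega>)\<^sup>2)"

end

theory Submission
  imports Defs
begin

text \<open>
  The estimation error is \<open>(\<Sum>i<N. \<tau>\<^sub>i\<^sub>+\<^sub>1 (B(\<tau>\<^sub>i\<^sub>+\<^sub>1) - B(\<tau>\<^sub>i))) / (\<Sum>i<N. \<tau>\<^sub>i\<^sub>+\<^sub>1\<^sup>2)\<close>.
  Summation by parts turns the numerator into
  \<open>\<tau>\<^sub>N B(\<tau>\<^sub>N) - (\<Sum>i<N. (\<tau>\<^sub>i\<^sub>+\<^sub>1 - \<tau>\<^sub>i) B(\<tau>\<^sub>i))\<close>; for nondecreasing sampling times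
  in \<open>[0, R]\<close> this is at most \<open>2 R\<close> times the supremum of \<open>\<bar>B\<bar>\<close> on \<open>[0, R]\<close>, which is finite
  because the path is continuous and which does not depend on \<open>N\<close>
  (\<open>weighted_increments_bounded\<close>). The denominator grows linearly in \<open>N\<close> as soon as the later half
  of the sampling times stays away from \<open>0\<close>. Hence the error tends to \<open>0\<close> along every single path
  for which the sampling times are eventually nondecreasing, bounded, and bounded away from \<open>0\<close> in
  their later half (\<open>weighted_increments_ratio_tendsto_0\<close>); all of the analysis of the process is
  pathwise.

  What remains is to verify this regularity of the sampling times almost surely. Jittered times have
  it for every \<open>N \<ge> 2\<close>, because each jitter is at most half a grid step. Renewal times are sums of
  exponential variables, and Chernoff bounds show that they violate it with probability decaying
  geometrically in \<open>N\<close> (\<open>chernoff_sum_exponential\<close>); the Borel--Cantelli lemma then applies,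
  however the schemes for different \<open>N\<close> are coupled.
\<close>

section \<open>Pathwise convergence\<close>

text \<open>The constants \<open>2\<close> and \<open>1 / 4\<close> only have to lie on the right side of the typical values: under
  both schemes the last sampling time is close to \<open>1\<close> and the middle one, of index
  \<open>\<lceil>N / 2\<rceil>\<close>, is close to \<open>1 / 2\<close>.\<close>

definition well_spread :: "nat \<Rightarrow> (nat \<Rightarrow> real) \<Rightarrow> bool" where
  "well_spread N t \<longleftrightarrow>
     t 0 = 0 \<and> (\<forall>i<N. t i \<le> t (Suc i)) \<and> t N \<le> 2 \<and> 1 / 4 \<le> t ((N + 1) div 2)"

lemma nondecreasing_upto:
  fixes t :: "nat \<Rightarrow> real"
  assumes "\<And>i. i < n \<Longrightarrow> t i \<le> t (Suc i)" "i \<le> j" "j \<le> n"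
  shows "t i \<le> t j"
  using assms(2,3)
proof (induction j rule: dec_induct)
  case (step k)
  then show ?case using assms(1)[of k] by simp
qed simp

text \<open>Summation by parts moves the increments from \<open>f\<close> to \<open>t\<close>, whose increments are nonnegative and
  telescope. A bound on \<open>f\<close> itself then suffices, although the increments of a rough path are
  not absolutely summable uniformly in the partition.\<close>

lemma weighted_increments_bounded:
  fixes f :: "real \<Rightarrow> real" and t :: "nat \<Rightarrow> real"
  assumes t0: "t 0 = 0" and mono: "\<And>i. i < n \<Longrightarrow> t i \<le> t (Suc i)" and tn: "t n \<le> R"
    and f: "\<And>x. 0 \<le> x \<Longrightarrow> x \<le> R \<Longrightarrow> \<bar>f x\<bar> \<le> K"
  shows "\<bar>\<Sum>i<n. t (Suc i) * (f (t (Suc i)) - f (t i))\<bar> \<le> 2 * R * K"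
proof -
  have le: "t i \<le> t j" if "i \<le> j" "j \<le> n" for i j
    using mono that by (rule nondecreasing_upto)
  have pos: "0 \<le> t i" if "i \<le> n" for i
    using le[of 0 i] that t0 by simp
  have R: "t i \<le> R" if "i \<le> n" for i
    using le[of i n] that tn by simp
  have K: "\<bar>f (t i)\<bar> \<le> K" if "i \<le> n" for i
    using f pos R that by blast
  have K0: "0 \<le> K"
    using K[of 0] by simp
  have by_parts: "(\<Sum>i<n. t (Suc i) * (f (t (Suc i)) - f (t i))) =
      t n * f (t n) - (\<Sum>i<n. (t (Suc i) - t i) * f (t i))"
  proof -
    have "(\<Sum>i<n. t (Suc i) * (f (t (Suc i)) - f (t i))) + (\<Sum>i<n. (t (Suc i) - t i) * f (t i)) =
        (\<Sum>i<n. t (Suc i) * f (t (Suc i)) - t i * f (t i))"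
      unfolding sum.distrib[symmetric] by (intro sum.cong) (auto simp: algebra_simps)
    also have "\<dots> = t n * f (t n)"
      by (subst sum_lessThan_telescope) (simp add: t0)
    finally show ?thesis by simp
  qed
  have "\<bar>t n * f (t n)\<bar> \<le> R * K"
    unfolding abs_mult using pos[of n] R[of n] K[of n] by (intro mult_mono) auto
  moreover have "\<bar>\<Sum>i<n. (t (Suc i) - t i) * f (t i)\<bar> \<le> R * K"
  proof -
    have "\<bar>\<Sum>i<n. (t (Suc i) - t i) * f (t i)\<bar> \<le> (\<Sum>i<n. (t (Suc i) - t i) * K)"
      using mono K by (intro sum_abs[THEN order_trans] sum_mono) (auto simp: abs_mult intro!: mult_left_mono)
    also have "\<dots> = t n * K"
      by (simp add: sum_distrib_right[symmetric] sum_lessThan_telescope t0)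
    also have "\<dots> \<le> R * K"
      using R[of n] K0 by (simp add: mult_right_mono)
    finally show ?thesis .
  qed
  ultimately show ?thesis
    unfolding by_parts by linarith
qed

lemma well_spread_sum_squares_ge:
  assumes "well_spread N t"
  shows "real N / 32 \<le> (\<Sum>i<N. (t (Suc i))\<^sup>2)"
proof -
  define m where "m = (N + 1) div 2"
  have late: "(1 / 4)\<^sup>2 \<le> (t i)\<^sup>2" if "i \<in> {m..N}" for i
  proof -
    have "1 / 4 \<le> t i"
      using nondecreasing_upto[of N t m i] assms that by (simp add: well_spread_def m_def)
    then show ?thesis by (intro power_mono) auto
  qed
  have "real N / 32 \<le> real (card {m..N}) * (1 / 4)\<^sup>2"
  proof -
    have "N \<le> 2 * card {m..N}" by (simp add: m_def)
    then have "real N \<le> 2 * real (card {m..N})" by linarith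
    then show ?thesis by (simp add: power2_eq_square)
  qed
  also have "\<dots> \<le> (\<Sum>i\<in>{m..N}. (t i)\<^sup>2)"
    using sum_bounded_below[of "{m..N}" "(1 / 4)\<^sup>2" "\<lambda>i. (t i)\<^sup>2"] late by simp
  also have "\<dots> \<le> (\<Sum>i\<le>N. (t i)\<^sup>2)"
    by (intro sum_mono2) auto
  also have "\<dots> = (\<Sum>i<N. (t (Suc i))\<^sup>2)"
    using assms by (simp add: well_spread_def sum.atMost_shift)
  finally show ?thesis .
qed

lemma weighted_increments_ratio_tendsto_0:
  fixes f :: "real \<Rightarrow> real" and t :: "nat \<Rightarrow> nat \<Rightarrow> real"
  assumes f: "continuous_on {0..} f" and t: "\<forall>\<^sub>F N in sequentially. well_spread N (t N)"
  shows "(\<lambda>N. (\<Sum>i<N. t N (Suc i) * (f (t N (Suc i)) - f (t N i))) / (\<Sum>i<N. (t N (Suc i))\<^sup>2))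
    \<longlonglongrightarrow> 0"
proof -
  have "continuous_on {0..2} f"
    using f by (rule continuous_on_subset) auto
  then have "bounded (f ` {0..2})"
    by (intro compact_imp_bounded compact_continuous_image) auto
  then obtain K where K: "\<And>x. 0 \<le> x \<Longrightarrow> x \<le> 2 \<Longrightarrow> \<bar>f x\<bar> \<le> K"
    unfolding bounded_iff by (metis atLeastAtMost_iff imageI real_norm_def)
  have "\<forall>\<^sub>F N in sequentially. norm ((\<Sum>i<N. t N (Suc i) * (f (t N (Suc i)) - f (t N i))) /
      (\<Sum>i<N. (t N (Suc i))\<^sup>2)) \<le> (128 * K) / real N"
    using t eventually_gt_at_top[of 0]
  proof eventually_elim
    case (elim N)
    have num: "\<bar>\<Sum>i<N. t N (Suc i) * (f (t N (Suc i)) - f (t N i))\<bar> \<le> 2 * 2 * K"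
      using elim(1) K by (intro weighted_increments_bounded) (auto simp: well_spread_def)
    note den = well_spread_sum_squares_ge[OF elim(1)]
    have "\<bar>\<Sum>i<N. t N (Suc i) * (f (t N (Suc i)) - f (t N i))\<bar> / (\<Sum>i<N. (t N (Suc i))\<^sup>2)
        \<le> (2 * 2 * K) / (real N / 32)"
      using num den elim(2) by (intro frac_le) auto
    moreover have "0 \<le> (\<Sum>i<N. (t N (Suc i))\<^sup>2)"
      by (intro sum_nonneg) auto
    ultimately show ?case by simp
  qed
  moreover have "(\<lambda>N. (128 * K) / real N) \<longlonglongrightarrow> 0"
    by (rule lim_const_over_n)
  ultimately show ?thesis
    by (rule Lim_null_comparison)
qed

lemma least_squares_estimator_eq:
  assumes Y: "\<And>i. i < N \<Longrightarrow> Y (Suc i) \<omega> = a * \<tau> (Suc i) \<omega> + f (\<tau> (Suc i) \<omega>) - f (\<tau> i \<omega>)"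
    and pos: "(\<Sum>i<N. (\<tau> (Suc i) \<omega>)\<^sup>2) \<noteq> 0"
  shows "least_squares_estimator N \<tau> Y \<omega> = a +
    (\<Sum>i<N. \<tau> (Suc i) \<omega> * (f (\<tau> (Suc i) \<omega>) - f (\<tau> i \<omega>))) / (\<Sum>i<N. (\<tau> (Suc i) \<omega>)\<^sup>2)"
proof -
  have "(\<Sum>i<N. \<tau> (Suc i) \<omega> * Y (Suc i) \<omega>) = a * (\<Sum>i<N. (\<tau> (Suc i) \<omega>)\<^sup>2) +
      (\<Sum>i<N. \<tau> (Suc i) \<omega> * (f (\<tau> (Suc i) \<omega>) - f (\<tau> i \<omega>)))"
    unfolding sum_distrib_left sum.distrib[symmetric]
    by (intro sum.cong) (auto simp: Y algebra_simps power2_eq_square)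
  then show ?thesis
    using pos by (simp add: least_squares_estimator_def atLeast0LessThan add_divide_distrib)
qed

section \<open>Jittered sampling\<close>

context prob_space
begin

text \<open>Neighbouring jitters differ by at most one grid step, which preserves the order of the grid
  points. At \<open>N = 1\<close> the last time can reach \<open>3 / 2\<close>, and for larger \<open>N\<close> the middle time is at
  least \<open>1 / 2 - 1 / (2 N)\<close>.\<close>

lemma jittered_sampling_well_spread:
  assumes jit: "jittered_sampling M N \<tau>" and N: "2 \<le> N"
  shows "AE \<omega> in M. well_spread N (\<lambda>i. \<tau> i \<omega>)"
proof -
  obtain \<nu> where \<nu>: "indep_vars (\<lambda>_. borel) \<nu> {1..N}"
    and distr: "\<And>i. i \<in> {1..N} \<Longrightarrow>
      distr M borel (\<nu> i) = uniform_measure lborel {- 1 / (2 * real N) .. 1 / (2 * real N)}"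
    and \<tau>: "\<And>\<omega>. \<omega> \<in> space M \<Longrightarrow> \<tau> 0 \<omega> = 0"
      "\<And>\<omega> i. \<omega> \<in> space M \<Longrightarrow> i \<in> {1..N} \<Longrightarrow> \<tau> i \<omega> = real i / real N + \<nu> i \<omega>"
    using jit unfolding jittered_sampling_def by blast
  have small: "AE \<omega> in M. \<bar>\<nu> i \<omega>\<bar> \<le> 1 / (2 * real N)" if i: "i \<in> {1..N}" for i
  proof -
    have "\<nu> i \<in> borel_measurable M"
      using \<nu> i by (auto simp: indep_vars_def)
    moreover have "AE x in distr M borel (\<nu> i). \<bar>x\<bar> \<le> 1 / (2 * real N)"
      unfolding distr[OF i] by (intro AE_uniform_measureI) auto
    ultimately show ?thesis
      by (rule AE_distrD)
  qed
  have "AE \<omega> in M. \<forall>i\<in>{1..N}. \<bar>\<nu> i \<omega>\<bar> \<le> 1 / (2 * real N)"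
    using small by (intro AE_finite_allI) auto
  then show ?thesis
    using AE_space
  proof eventually_elim
    case (elim \<omega>)
    have upper: "\<tau> i \<omega> \<le> (real i + 1 / 2) / real N" if "i \<in> {1..N}" for i
      using elim(1)[rule_format, OF that] \<tau>(2)[OF elim(2) that] by (simp add: add_divide_distrib)
    have lower: "(real i - 1 / 2) / real N \<le> \<tau> i \<omega>" if "i \<in> {1..N}" for i
      using elim(1)[rule_format, OF that] \<tau>(2)[OF elim(2) that] by (simp add: diff_divide_distrib)
    have step: "\<tau> i \<omega> \<le> \<tau> (Suc i) \<omega>" if "i < N" for i
    proof -
      have "\<tau> i \<omega> \<le> (real i + 1 / 2) / real N"
        using upper[of i] \<tau>(1)[OF elim(2)] that by (cases "i = 0") auto
      then show ?thesis
        using lower[of "Suc i"] that by (simp add: add_divide_distrib diff_divide_distrib)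
    qed
    have last: "\<tau> N \<omega> \<le> 2"
    proof -
      have "(real N + 1 / 2) / real N \<le> 2"
        using N by (simp add: field_simps)
      then show ?thesis using upper[of N] N by auto
    qed
    have middle: "1 / 4 \<le> \<tau> ((N + 1) div 2) \<omega>"
    proof -
      have "N \<le> 2 * ((N + 1) div 2)" by simp
      then have "real N \<le> 2 * real ((N + 1) div 2)" by linarith
      then have "1 / 4 \<le> (real ((N + 1) div 2) - 1 / 2) / real N"
        using N by (simp add: field_simps)
      moreover have "(N + 1) div 2 \<in> {1..N}"
        using N by auto
      ultimately show ?thesis
        using lower order_trans by blast
    qed
    show ?case
      unfolding well_spread_def using \<tau>(1)[OF elim(2)] step last middle by blast
  qed
qed

section \<open>Renewal sampling\<close>

lemma exponential_mgf:
  assumes D: "distributed M lborel X (exponential_density l)" and l: "0 < l" and \<theta>: "\<theta> < l"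
  shows "(\<integral>\<^sup>+\<omega>. ennreal (exp (\<theta> * X \<omega>)) \<partial>M) = ennreal (l / (l - \<theta>))"
proof -
  interpret E: prob_space "density lborel (exponential_density (l - \<theta>))"
    using \<theta> by (intro prob_space_exponential_density) simp
  have "(\<integral>\<^sup>+\<omega>. ennreal (exp (\<theta> * X \<omega>)) \<partial>M) =
      (\<integral>\<^sup>+x. ennreal (exponential_density l x) * ennreal (exp (\<theta> * x)) \<partial>lborel)"
    by (rule distributed_nn_integral[OF D, symmetric]) simp
  \<comment> \<open>Tilting an exponential density by \<open>exp (\<theta> x)\<close> gives a multiple of another one.\<close>
  also have "\<dots> = (\<integral>\<^sup>+x. ennreal (l / (l - \<theta>)) * ennreal (exponential_density (l - \<theta>) x) \<partial>lborel)"
    using l \<theta>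
    by (intro nn_integral_cong)
      (auto simp: exponential_density_def ennreal_mult[symmetric] exp_add[symmetric] field_simps)
  also have "\<dots> = ennreal (l / (l - \<theta>)) * (\<integral>\<^sup>+x. ennreal (exponential_density (l - \<theta>) x) \<partial>lborel)"
    by (intro nn_integral_cmult) simp
  also have "(\<integral>\<^sup>+x. ennreal (exponential_density (l - \<theta>) x) \<partial>lborel) = 1"
    using E.emeasure_space_1 by (simp add: emeasure_density)
  finally show ?thesis by simp
qed

text \<open>Markov's inequality for \<open>exp (\<theta> (\<Sum>j\<in>I. t\<^sub>j))\<close>, whose expectation factors by independence.
  Positive \<open>\<theta>\<close> bounds the upper tail of the sum, negative \<open>\<theta>\<close> the lower tail.\<close>

lemma chernoff_sum_exponential:
  assumes indep: "indep_vars (\<lambda>_. borel) t I" and I: "finite I"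
    and D: "\<And>j. j \<in> I \<Longrightarrow> distributed M lborel (t j) (exponential_density l)"
    and l: "0 < l" and \<theta>: "\<theta> < l"
  shows "prob {\<omega>\<in>space M. c \<le> \<theta> * (\<Sum>j\<in>I. t j \<omega>)} \<le> exp (- c) * (l / (l - \<theta>)) ^ card I"
proof -
  have [measurable]: "t j \<in> borel_measurable M" if "j \<in> I" for j
    using indep that by (auto simp: indep_vars_def)
  have "emeasure M {\<omega>\<in>space M. c \<le> \<theta> * (\<Sum>j\<in>I. t j \<omega>)} \<le> ennreal (exp (- c)) *
      (\<integral>\<^sup>+\<omega>. ennreal (exp (\<theta> * (\<Sum>j\<in>I. t j \<omega>))) * indicator (space M) \<omega> \<partial>M)"
    using Chernoff_ineq_nn_integral_ge[of 1 "space M" M "\<lambda>\<omega>. \<theta> * (\<Sum>j\<in>I. t j \<omega>)" c] by simp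
  also have "(\<integral>\<^sup>+\<omega>. ennreal (exp (\<theta> * (\<Sum>j\<in>I. t j \<omega>))) * indicator (space M) \<omega> \<partial>M) =
      (\<integral>\<^sup>+\<omega>. (\<Prod>j\<in>I. ennreal (exp (\<theta> * t j \<omega>))) \<partial>M)"
    by (intro nn_integral_cong) (simp add: sum_distrib_left exp_sum I prod_ennreal)
  also have "\<dots> = (\<Prod>j\<in>I. \<integral>\<^sup>+\<omega>. ennreal (exp (\<theta> * t j \<omega>)) \<partial>M)"
    by (intro indep_vars_nn_integral I indep_vars_compose2[OF indep]) auto
  also have "\<dots> = (\<Prod>j\<in>I. ennreal (l / (l - \<theta>)))"
    by (intro prod.cong refl exponential_mgf D l \<theta>)
  also have "\<dots> = ennreal ((l / (l - \<theta>)) ^ card I)"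
    using l \<theta> by (simp add: ennreal_power)
  finally show ?thesis
    using l \<theta> by (simp add: emeasure_eq_measure ennreal_mult[symmetric])
qed

lemma renewal_sampling_nondecreasing:
  assumes ren: "renewal_sampling M N \<tau>" and N: "1 \<le> N"
  shows "AE \<omega> in M. \<tau> 0 \<omega> = 0 \<and> (\<forall>i<N. \<tau> i \<omega> \<le> \<tau> (Suc i) \<omega>)"
proof -
  obtain t where D: "\<And>j. j \<in> {1..N} \<Longrightarrow> distributed M lborel (t j) (exponential_density (real N))"
    and \<tau>: "\<And>\<omega>. \<omega> \<in> space M \<Longrightarrow> \<tau> 0 \<omega> = 0"
      "\<And>\<omega> i. \<omega> \<in> space M \<Longrightarrow> i \<in> {1..N} \<Longrightarrow> \<tau> i \<omega> = (\<Sum>j=1..i. t j \<omega>)"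
    using ren unfolding renewal_sampling_def by blast
  have "AE \<omega> in M. 0 \<le> t j \<omega>" if "j \<in> {1..N}" for j
    by (subst distributed_AE2[OF D[OF that]]) (auto simp: exponential_density_def)
  then have "AE \<omega> in M. \<forall>j\<in>{1..N}. 0 \<le> t j \<omega>"
    by (intro AE_finite_allI) auto
  then show ?thesis
    using AE_space
  proof eventually_elim
    case (elim \<omega>)
    have "\<tau> i \<omega> \<le> \<tau> (Suc i) \<omega>" if "i < N" for i
      using that elim(1) \<tau>(1)[OF elim(2)] \<tau>(2)[OF elim(2), of i] \<tau>(2)[OF elim(2), of "Suc i"]
      by (cases "i = 0") auto
    then show ?case using \<tau>(1)[OF elim(2)] by blast
  qed
qed

text \<open>With tilts \<open>\<theta> = N / 2\<close> and \<open>\<theta> = - N\<close> the moment generating function of each waiting time is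
  \<open>2\<close> and \<open>1 / 2\<close>. This gives the bounds \<open>exp (- N) 2\<^sup>N\<close> for the upper and
  \<open>exp (N / 4) (1 / 2) ^ \<lceil>N / 2\<rceil>\<close> for the lower tail. Since \<open>ln 2\<close> lies in the interval
  \<open>[2 / 3, 25 / 36]\<close>, both are at most \<open>exp (- N / 12)\<close>.\<close>

lemma renewal_sampling_tails:
  assumes ren: "renewal_sampling M N \<tau>" and N: "1 \<le> N"
  shows "{\<omega>\<in>space M. 2 \<le> \<tau> N \<omega> \<or> \<tau> ((N + 1) div 2) \<omega> \<le> 1 / 4} \<in> events" (is "?A \<in> _")
    and "prob {\<omega>\<in>space M. 2 \<le> \<tau> N \<omega> \<or> \<tau> ((N + 1) div 2) \<omega> \<le> 1 / 4} \<le> 2 * exp (- 1 / 12) ^ N"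
proof -
  obtain t where indep: "indep_vars (\<lambda>_. borel) t {1..N}"
    and D: "\<And>j. j \<in> {1..N} \<Longrightarrow> distributed M lborel (t j) (exponential_density (real N))"
    and \<tau>: "\<And>\<omega> i. \<omega> \<in> space M \<Longrightarrow> i \<in> {1..N} \<Longrightarrow> \<tau> i \<omega> = (\<Sum>j=1..i. t j \<omega>)"
    using ren unfolding renewal_sampling_def by blast
  define m where "m = (N + 1) div 2"
  have m: "m \<in> {1..N}" "N \<in> {1..N}"
    using N by (auto simp: m_def)
  have t[measurable]: "t j \<in> borel_measurable M" if "j \<in> {1..N}" for j
    using indep that by (auto simp: indep_vars_def)
  have S[measurable]: "(\<lambda>\<omega>. \<Sum>j=1..i. t j \<omega>) \<in> borel_measurable M" if "i \<in> {1..N}" for i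
    using that by (intro borel_measurable_sum t) auto
  note S' = S[OF m(1)] S[OF m(2)]
  define U where "U = {\<omega>\<in>space M. real N \<le> (real N / 2) * (\<Sum>j=1..N. t j \<omega>)}"
  define L where "L = {\<omega>\<in>space M. - real N / 4 \<le> (- real N) * (\<Sum>j=1..m. t j \<omega>)}"
  have U_sets: "U \<in> events" and L_sets: "L \<in> events"
    unfolding U_def L_def using S' by measurable
  have bad: "?A = U \<union> L"
    using N m unfolding m_def[symmetric] by (auto simp: U_def L_def \<tau> field_simps)
  show "?A \<in> events"
    unfolding bad using U_sets L_sets by blast
  have ln2: "2 / 3 \<le> ln (2::real)" "ln (2::real) \<le> 25 / 36"
    using ln2_ge_two_thirds ln2_le_25_over_36 by simp_all
  have "prob U \<le> exp (- real N) * (real N / (real N - real N / 2)) ^ card {1..N}"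
    unfolding U_def by (rule chernoff_sum_exponential[OF indep _ D]) (use N in auto)
  also have "\<dots> = exp (- real N) * 2 ^ N"
    using N by simp
  also have "\<dots> = exp (real N * (ln 2 - 1))"
    by (simp add: right_diff_distrib exp_diff exp_minus exp_of_nat_mult field_simps)
  also have "\<dots> \<le> exp (real N * (- 1 / 12))"
    using ln2 by (intro exp_mono mult_left_mono) auto
  finally have PU: "prob U \<le> exp (real N * (- 1 / 12))" .
  have sub: "{1..m} \<subseteq> {1..N}"
    using m by auto
  have "prob L \<le> exp (- (- real N / 4)) * (real N / (real N - - real N)) ^ card {1..m}"
    unfolding L_def
    by (rule chernoff_sum_exponential[OF indep_vars_subset[OF indep sub] _ D])
      (use N sub in auto)
  also have "\<dots> = exp (real N / 4) * (1 / 2) ^ m"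
    using N by simp
  also have "\<dots> = exp (real N / 4 - real m * ln 2)"
    by (simp add: exp_diff exp_of_nat_mult power_divide)
  also have "\<dots> \<le> exp (real N * (- 1 / 12))"
  proof -
    have "N \<le> 2 * m" by (simp add: m_def)
    then have "real N / 2 \<le> real m" by linarith
    then have "(real N / 2) * (2 / 3) \<le> real m * ln 2"
      using ln2 by (intro mult_mono) auto
    then show ?thesis by simp
  qed
  finally have PL: "prob L \<le> exp (real N * (- 1 / 12))" .
  have "prob (U \<union> L) \<le> prob U + prob L"
    using U_sets L_sets by (rule measure_Un_le)
  also have "\<dots> \<le> 2 * exp (real N * (- 1 / 12))"
    using PU PL by simp
  finally show "prob ?A \<le> 2 * exp (- 1 / 12) ^ N"
    unfolding bad exp_of_nat_mult .
qed

lemma renewal_sampling_well_spread: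
  assumes ren: "\<And>N. 1 \<le> N \<Longrightarrow> renewal_sampling M N (\<tau> N)"
  shows "AE \<omega> in M. \<forall>\<^sub>F N in sequentially. well_spread N (\<lambda>i. \<tau> N i \<omega>)"
proof -
  \<comment> \<open>The shift avoids \<open>\<tau> 0\<close>, which is unconstrained and could yield a nonmeasurable event.\<close>
  define A where
    "A n = {\<omega>\<in>space M. 2 \<le> \<tau> (Suc n) (Suc n) \<omega> \<or> \<tau> (Suc n) ((Suc n + 1) div 2) \<omega> \<le> 1 / 4}" for n
  have A_sets: "A n \<in> events" for n
    unfolding A_def by (intro renewal_sampling_tails(1) ren) simp_all
  have A_prob: "prob (A n) \<le> 2 * exp (- 1 / 12) ^ Suc n" for n
    unfolding A_def by (intro renewal_sampling_tails(2) ren) simp_all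
  have "summable (\<lambda>n. prob (A n))"
  proof (rule summable_comparison_test')
    have "summable (\<lambda>n. exp (- 1 / 12 :: real) ^ n)"
      by (intro summable_geometric) simp
    then show "summable (\<lambda>n. 2 * exp (- 1 / 12 :: real) ^ Suc n)"
      by (intro summable_mult) (subst summable_Suc_iff)
  qed (use A_prob in auto)
  then have "AE \<omega> in M. \<forall>\<^sub>F n in sequentially. \<omega> \<in> space M - A n"
    using A_sets by (intro borel_cantelli_AE1) (auto simp: emeasure_eq_measure)
  moreover have "AE \<omega> in M. \<forall>n. \<tau> (Suc n) 0 \<omega> = 0 \<and>
      (\<forall>i<Suc n. \<tau> (Suc n) i \<omega> \<le> \<tau> (Suc n) (Suc i) \<omega>)"
    unfolding AE_all_countable by (intro allI renewal_sampling_nondecreasing ren) simp_all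
  ultimately show ?thesis
  proof eventually_elim
    case (elim \<omega>)
    note nondecreasing = elim(2)
    have "\<forall>\<^sub>F n in sequentially. well_spread (Suc n) (\<lambda>i. \<tau> (Suc n) i \<omega>)"
      using elim(1)
    proof eventually_elim
      case (elim n)
      then show ?case
        using nondecreasing by (auto simp: well_spread_def A_def)
    qed
    then show ?case
      by (rule eventually_sequentially_Suc[THEN iffD1])
  qed
qed

end

section \<open>Strong consistency\<close>

theorem theorem3p1:
  fixes M :: "'w measure"
    and H \<sigma> a :: real
    and B :: "real \<Rightarrow> 'w \<Rightarrow> real"
    and \<tau> Y :: "nat \<Rightarrow> nat \<Rightarrow> 'w \<Rightarrow> real"
  assumes "prob_space M"
    and "1 / 2 < H" and "H < 1" and "0 < \<sigma>"
    and "fractional_brownian_motion M H \<sigma> B"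
    and "(\<forall>N\<ge>1. jittered_sampling M N (\<tau> N)) \<or> (\<forall>N\<ge>1. renewal_sampling M N (\<tau> N))"
    and "\<And>N. N \<ge> 1 \<Longrightarrow> times_indep_of_process M N (\<tau> N) B"
    and "\<And>N i \<omega>. N \<ge> 1 \<Longrightarrow> i < N \<Longrightarrow> \<omega> \<in> space M \<Longrightarrow>
           Y N (i + 1) \<omega> =
             a * \<tau> N (i + 1) \<omega> + B (\<tau> N (i + 1) \<omega>) \<omega> - B (\<tau> N i \<omega>) \<omega>"
  shows "AE \<omega> in M. (\<lambda>N. least_squares_estimator N (\<tau> N) (Y N) \<omega>) \<longlonglongrightarrow> a"
proof -
  interpret prob_space M by fact
  have "AE \<omega> in M. \<forall>\<^sub>F N in sequentially. well_spread N (\<lambda>i. \<tau> N i \<omega>)"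
    using assms(6)
  proof
    assume jit: "\<forall>N\<ge>1. jittered_sampling M N (\<tau> N)"
    have "AE \<omega> in M. \<forall>N. 2 \<le> N \<longrightarrow> well_spread N (\<lambda>i. \<tau> N i \<omega>)"
      unfolding AE_all_countable
    proof (intro allI)
      fix N :: nat
      show "AE \<omega> in M. 2 \<le> N \<longrightarrow> well_spread N (\<lambda>i. \<tau> N i \<omega>)"
        using jittered_sampling_well_spread[of N "\<tau> N"] jit by (cases "2 \<le> N") auto
    qed
    then show ?thesis
      by eventually_elim (auto simp: eventually_sequentially)
  next
    assume "\<forall>N\<ge>1. renewal_sampling M N (\<tau> N)"
    then show ?thesis
      by (intro renewal_sampling_well_spread) simp
  qed
  then show ?thesis
    using AE_space
  proof eventually_elim
    case (elim \<omega>)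
    let ?e = "\<lambda>N. (\<Sum>i<N. \<tau> N (Suc i) \<omega> * (B (\<tau> N (Suc i) \<omega>) \<omega> - B (\<tau> N i \<omega>) \<omega>)) /
      (\<Sum>i<N. (\<tau> N (Suc i) \<omega>)\<^sup>2)"
    have "continuous_on {0..} (\<lambda>t. B t \<omega>)"
      using assms(5) elim(2) by (simp add: fractional_brownian_motion_def)
    then have "?e \<longlonglongrightarrow> 0"
      using elim(1) by (rule weighted_increments_ratio_tendsto_0)
    then have "(\<lambda>N. a + ?e N) \<longlonglongrightarrow> a"
      using tendsto_add[OF tendsto_const[of a]] by fastforce
    moreover have "\<forall>\<^sub>F N in sequentially. a + ?e N = least_squares_estimator N (\<tau> N) (Y N) \<omega>"
      using elim(1) eventually_gt_at_top[of 0]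
    proof eventually_elim
      case (elim N)
      have "0 < (\<Sum>i<N. (\<tau> N (Suc i) \<omega>)\<^sup>2)"
        using well_spread_sum_squares_ge[OF elim(1)] elim(2) by simp
      moreover have "Y N (Suc i) \<omega> = a * \<tau> N (Suc i) \<omega> + B (\<tau> N (Suc i) \<omega>) \<omega> - B (\<tau> N i \<omega>) \<omega>"
        if "i < N" for i
        using assms(8)[of N i \<omega>] that \<open>\<omega> \<in> space M\<close> by simp
      ultimately show ?case
        by (intro least_squares_estimator_eq[where f="\<lambda>x. B x \<omega>", symmetric]) auto
    qed
    ultimately show ?case
      by (rule Lim_transform_eventually)
  qed
qed

end
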